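(* Let $(Q,\lhd,a\mapsto a^2)$ be a squandle and let $\chi\colon Q\times Q\to\mathbb{Z}$ and $\lambda\colon Q\to\mathbb{Z}$ be maps. Consider the weight function on special points of $Q$-colored diagrams of well-oriented knotted $3$-valent graphs given as follows. A crossing with over-arc colored $b$, under-arc on the right of the over-arc colored $a$ and under-arc on the left of the over-arc colored $a\lhd b$ has weight $\chi(a,b)$ if the under-strand is oriented from the $a$-colored arc to the $(a\lhd b)$-colored arc, and weight $-\chi(a,b)$ otherwise. An unzip vertex with both outgoing arcs colored $a$ has weight $\lambda(a)$, and a zip vertex with both incoming arcs colored $a$ has weight $-\lambda(a)$. This weight function is Boltzmann if and only if $(\chi,\lambda)$ is a squandle $2$-cocycle of $Q$.
   Context: **Graphs and diagrams.** A knotted $3$-valent graph is an embedding of an abstract $3$-valent graph into $\mathbb{R}^3$; diagrams are its generic projections to $\mathbb{R}^2$ with over/under information at crossings. An oriented $3$-valent graph is well-oriented if each vertex is a zip vertex (two incoming edges, one outgoing) or an unzip vertex (one incoming edge, two outgoing). The special points of a diagram are its crossings and its $3$-valent vertices. An arc is a part of the diagram delimited by special points, where the over-strand is not cut at a crossing. A sub-diagram is a part of a diagram contained in a disc, e.g. either side of an R-move. "Right" and "left" of an over-arc are with respect to its orientation. **R-moves.** These are the local moves: I, II, III (the usual Reidemeister moves); IV (a strand passing under a $3$-valent vertex is moved from one side of the vertex to the other); V (a crossing between two edges adjacent to a vertex, located next to this vertex, is added or removed); VI (a strand passing over a $3$-valent vertex is moved from one side of the vertex to the other). All these moves are considered with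 all orientations for which the diagrams involved are well-oriented. **Squandles.** $(Q,\lhd,a\mapsto a^2)$ is a squandle if there is a (necessarily unique) binary operation $\widetilde{\lhd}$ on $Q$ such that for all $a,b,c\in Q$: $(a\lhd b)\lhd c=(a\lhd c)\lhd(b\lhd c)$; $(a\lhd b)\,\widetilde{\lhd}\, b=(a\,\widetilde{\lhd}\, b)\lhd b=a$; $a\lhd a=a$; $a\lhd b^2=(a\lhd b)\lhd b$; $a^2\lhd b=(a\lhd b)^2$. **Squandle $2$-cocycles.** A squandle $2$-cocycle of $Q$ is a pair of maps $\chi\colon Q\times Q\to\mathbb{Z}$, $\lambda\colon Q\to\mathbb{Z}$ such that for all $a,b,c\in Q$: $\chi(a,b)+\chi(a\lhd b,c)=\chi(a\lhd c,b\lhd c)+\chi(a,c)$; $\chi(a,a)=0$; $\chi(a,b^2)=\chi(a,b)+\chi(a\lhd b,b)$; $\chi(a^2,b)+\lambda(a\lhd b)=2\chi(a,b)+\lambda(a)$. **Squandle colorings.** A $Q$-coloring of a (sub-)diagram is a map from its set of arcs to $Q$ such that: (A) at each crossing, if the over-arc has color $b$ and the under-arc lying to the right of the over-arc has color $a$, then the under-arc lying to the left of the over-arc has color $a\lhd b$; (C) at each zip vertex the two incoming arcs have the same color $a$ and the outgoing arc has color $a^2$; at each unzip vertex the two outgoing arcs have the same color $a$ and the incoming arc has color $a^2$. These rules are topological: if $D'$ is obtained from $D$ by one R-move, every coloring $\mathcal{C}$ of $D$ corresponds to a unique coloring $\mathcal{C}'$ of $D'$ coinciding with $\mathcal{C}$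 outside the small ball where the move is performed. **Boltzmann weight functions.** The weight of a colored (sub-)diagram is the sum of the weights of all its special points. A weight function is Boltzmann if, for any R-move, the weights of the two sub-diagrams involved, endowed with corresponding colorings, coincide. *)

theory Defs
  imports Main
begin

section \<open>Squandles and squandle 2-cocycles\<close>

definition squandle :: "('q \<Rightarrow> 'q \<Rightarrow> 'q) \<Rightarrow> ('q \<Rightarrow> 'q) \<Rightarrow> bool" where
  "squandle tri sq \<longleftrightarrow>
     (\<exists>tri' :: 'q \<Rightarrow> 'q \<Rightarrow> 'q. \<forall>a b c.
        tri (tri a b) c = tri (tri a c) (tri b c) \<and>
        tri' (tri a b) b = a \<and> tri (tri' a b) b = a \<and>
        tri a a = a \<and>
        tri a (sq b) = tri (tri a b) b \<and>
        tri (sq a) b = sq (tri a b))"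

definition squandle_2_cocycle ::
  "('q \<Rightarrow> 'q \<Rightarrow> 'q) \<Rightarrow> ('q \<Rightarrow> 'q) \<Rightarrow> ('q \<Rightarrow> 'q \<Rightarrow> int) \<Rightarrow> ('q \<Rightarrow> int) \<Rightarrow> bool" where
  "squandle_2_cocycle tri sq \<chi> lam \<longleftrightarrow>
     (\<forall>a b c.
        \<chi> a b + \<chi> (tri a b) c = \<chi> (tri a c) (tri b c) + \<chi> a c \<and>
        \<chi> a a = 0 \<and>
        \<chi> a (sq b) = \<chi> a b + \<chi> (tri a b) b \<and>
        \<chi> (sq a) b + lam (tri a b) = 2 * \<chi> a b + lam a)"


section \<open>Sub-diagrams\<close>

text \<open>
  Sub-diagrams are encoded by planar diagram codes. Cutting all strands, the over-strands included,
  at the special points yields edges, which are labelled by natural numbers. A special point is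
  given by its ends listed counterclockwise. In a crossing \<open>Crossing u x v y\<close> the under-strand runs
  through \<open>u\<close> and \<open>v\<close>, the over-strand through \<open>x\<close> and \<open>y\<close>. The boundary of a sub-diagram lists the
  ends on the boundary circle of its disc, again counterclockwise.

  The type parameter holds the data attached to an end: the label of its edge for an unoriented
  shape, that label and a direction for an oriented sub-diagram, and a color and a direction for a
  colored one.
\<close>

datatype 'a special_point = Crossing 'a 'a 'a 'a | Vertex 'a 'a 'a

datatype 'a sub_diagram = Sub_Diagram (points: "'a special_point list") (boundary: "'a list")

text \<open>
  \<open>Head\<close> marks the end at which an oriented edge terminates, \<open>Tail\<close> the one at which it starts. So at
  a special point \<open>Head\<close> means incoming, and on the boundary it means that the edge leaves the disc.
\<close>

datatype dir = Head | Tail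

fun ends :: "'a special_point \<Rightarrow> 'a list" where
  "ends (Crossing u x v y) = [u, x, v, y]"
| "ends (Vertex x y z) = [x, y, z]"

definition all_ends :: "'a sub_diagram \<Rightarrow> 'a list" where
  "all_ends D = concat (map ends (points D)) @ boundary D"

definition incoming :: "('a \<times> dir) special_point \<Rightarrow> ('a \<times> dir) list" where
  "incoming p = filter (\<lambda>x. snd x = Head) (ends p)"

definition outgoing :: "('a \<times> dir) special_point \<Rightarrow> ('a \<times> dir) list" where
  "outgoing p = filter (\<lambda>x. snd x = Tail) (ends p)"

fun zip_vertex :: "('a \<times> dir) special_point \<Rightarrow> bool" where
  "zip_vertex (Crossing u x v y) \<longleftrightarrow> False"
| "zip_vertex (Vertex x y z) \<longleftrightarrow>
     length (incoming (Vertex x y z)) = 2 \<and> length (outgoing (Vertex x y z)) = 1"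

fun unzip_vertex :: "('a \<times> dir) special_point \<Rightarrow> bool" where
  "unzip_vertex (Crossing u x v y) \<longleftrightarrow> False"
| "unzip_vertex (Vertex x y z) \<longleftrightarrow>
     length (incoming (Vertex x y z)) = 1 \<and> length (outgoing (Vertex x y z)) = 2"

fun well_oriented_point :: "('a \<times> dir) special_point \<Rightarrow> bool" where
  "well_oriented_point (Crossing u x v y) \<longleftrightarrow> snd u \<noteq> snd v \<and> snd x \<noteq> snd y"
| "well_oriented_point (Vertex x y z) \<longleftrightarrow>
     zip_vertex (Vertex x y z) \<or> unzip_vertex (Vertex x y z)"

definition well_oriented :: "(nat \<times> dir) sub_diagram \<Rightarrow> bool" where
  "well_oriented D \<longleftrightarrow>
     (\<forall>e \<in> fst ` set (all_ends D). \<forall>d. count_list (all_ends D) (e, d) = 1) \<and>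
     (\<forall>p \<in> set (points D). well_oriented_point p)"

text \<open>
  With the ends of a crossing in counterclockwise order, a traveller entering along \<open>x\<close> and leaving
  along \<open>y\<close> has \<open>v\<close> on the right and \<open>u\<close> on the left.
\<close>

fun right_under :: "('a \<times> dir) special_point \<Rightarrow> 'a \<times> dir" where
  "right_under (Crossing u x v y) = (if snd x = Head then v else u)"

fun left_under :: "('a \<times> dir) special_point \<Rightarrow> 'a \<times> dir" where
  "left_under (Crossing u x v y) = (if snd x = Head then u else v)"


section \<open>Colorings\<close>

text \<open>An arc is the set of those edges which are joined to each other through over-strands.\<close>

definition over_pairs :: "(nat \<times> dir) sub_diagram \<Rightarrow> (nat \<times> nat) set" where
  "over_pairs D = {(fst x, fst y) | u x v y. Crossing u x v y \<in> set (points D)}"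

definition arc_of :: "(nat \<times> dir) sub_diagram \<Rightarrow> nat \<Rightarrow> nat set" where
  "arc_of D e = {e'. (e, e') \<in> (over_pairs D \<union> (over_pairs D)\<inverse>)\<^sup>*}"

text \<open>The values of \<open>C\<close> outside the set of arcs of \<open>D\<close> are never used.\<close>

definition colored :: "(nat \<times> dir) sub_diagram \<Rightarrow> (nat set \<Rightarrow> 'q) \<Rightarrow> ('q \<times> dir) sub_diagram" where
  "colored D C = map_sub_diagram (\<lambda>(e, d). (C (arc_of D e), d)) D"

fun coloring_rule ::
  "('q \<Rightarrow> 'q \<Rightarrow> 'q) \<Rightarrow> ('q \<Rightarrow> 'q) \<Rightarrow> ('q \<times> dir) special_point \<Rightarrow> bool" where
  "coloring_rule tri sq (Crossing u x v y) \<longleftrightarrow>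
     fst (left_under (Crossing u x v y)) = tri (fst (right_under (Crossing u x v y))) (fst x)"
| "coloring_rule tri sq (Vertex x y z) \<longleftrightarrow>
     (zip_vertex (Vertex x y z) \<longrightarrow>
       (\<exists>a. (\<forall>s \<in> set (incoming (Vertex x y z)). fst s = a) \<and>
            (\<forall>s \<in> set (outgoing (Vertex x y z)). fst s = sq a))) \<and>
     (unzip_vertex (Vertex x y z) \<longrightarrow>
       (\<exists>a. (\<forall>s \<in> set (outgoing (Vertex x y z)). fst s = a) \<and>
            (\<forall>s \<in> set (incoming (Vertex x y z)). fst s = sq a)))"

definition coloring ::
  "('q \<Rightarrow> 'q \<Rightarrow> 'q) \<Rightarrow> ('q \<Rightarrow> 'q) \<Rightarrow> (nat \<times> dir) sub_diagram \<Rightarrow> (nat set \<Rightarrow> 'q) \<Rightarrow> bool" where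
  "coloring tri sq D C \<longleftrightarrow> (\<forall>p \<in> set (points (colored D C)). coloring_rule tri sq p)"


section \<open>R-moves\<close>

text \<open>
  Both sides of each R-move, without orientations, and up to planar isotopy, relabelling of the edges
  and exchange of the two sides. The two boundary lists of a move describe the same points of the
  boundary circle in the same order.
\<close>

text \<open>The two shapes differ by the crossing being switched; rotating the disc by a half-turn puts
  the curl on the other side of the strand.\<close>

definition move_I :: "(nat sub_diagram \<times> nat sub_diagram) set" where
  "move_I =
    {(Sub_Diagram [] [1, 1],
      Sub_Diagram [Crossing 1 3 2 2] [1, 3]),
     (Sub_Diagram [] [1, 1],
      Sub_Diagram [Crossing 1 2 2 3] [1, 3])}"

text \<open>Two vertical strands; the boundary is listed as SW, SE, NE, NW. The left strand is pushed under
  the right one; the other choice is obtained by a half-turn.\<close>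

definition move_II :: "(nat sub_diagram \<times> nat sub_diagram) set" where
  "move_II =
    {(Sub_Diagram [] [1, 4, 4, 1],
      Sub_Diagram [Crossing 1 4 2 5, Crossing 2 6 3 5] [1, 4, 6, 3])}"

text \<open>
  The lowest strand, from W to E, has edges 1, 2, 3; it passes south, respectively north, of the
  crossing of the strand 4, 5, 6 from SW to NE and the strand 7, 8, 9 from NW to SE. The boundary is
  listed as W, SW, SE, E, NE, NW. In the first shape the SW--NE strand is below the NW--SE strand, in
  the second one above. The remaining height orders are obtained by rotations by multiples of a
  sixth of a turn.
\<close>

definition move_III :: "(nat sub_diagram \<times> nat sub_diagram) set" where
  "move_III =
    {(Sub_Diagram [Crossing 1 4 2 5, Crossing 2 9 3 8, Crossing 5 8 6 7] [1, 4, 9, 3, 6, 7],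
      Sub_Diagram [Crossing 1 8 2 7, Crossing 2 5 3 6, Crossing 4 9 5 8] [1, 4, 9, 3, 6, 7]),
     (Sub_Diagram [Crossing 1 4 2 5, Crossing 2 9 3 8, Crossing 7 5 8 6] [1, 4, 9, 3, 6, 7],
      Sub_Diagram [Crossing 1 8 2 7, Crossing 2 5 3 6, Crossing 8 4 9 5] [1, 4, 9, 3, 6, 7])}"

text \<open>
  The vertex has edges going N, SW and SE. The moving strand, from W to E, has edges 1, 2 when it
  passes north of the vertex and 1, 2, 3 when it passes south of it. The boundary is listed as W, SW,
  SE, E, N.
\<close>

definition move_IV :: "(nat sub_diagram \<times> nat sub_diagram) set" where
  "move_IV =
    {(Sub_Diagram [Crossing 1 5 2 4, Vertex 5 6 7] [1, 6, 7, 2, 4],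
      Sub_Diagram [Crossing 1 6 2 8, Crossing 2 7 3 9, Vertex 4 8 9] [1, 6, 7, 3, 4])}"

text \<open>The vertex has edges going SW, SE and N, which is also the order of the boundary. The SW and SE
  edges cross, with either of them below.\<close>

definition move_V :: "(nat sub_diagram \<times> nat sub_diagram) set" where
  "move_V =
    {(Sub_Diagram [Vertex 1 2 3] [1, 2, 3],
      Sub_Diagram [Crossing 1 2 4 5, Vertex 5 4 3] [1, 2, 3]),
     (Sub_Diagram [Vertex 1 2 3] [1, 2, 3],
      Sub_Diagram [Crossing 2 4 5 1, Vertex 5 4 3] [1, 2, 3])}"

text \<open>As in move IV, with the moving strand above.\<close>

definition move_VI :: "(nat sub_diagram \<times> nat sub_diagram) set" where
  "move_VI =
    {(Sub_Diagram [Crossing 5 2 4 1, Vertex 5 6 7] [1, 6, 7, 2, 4],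
      Sub_Diagram [Crossing 6 2 8 1, Crossing 7 3 9 2, Vertex 4 8 9] [1, 6, 7, 3, 4])}"

definition R_move :: "(nat \<times> dir) sub_diagram \<Rightarrow> (nat \<times> dir) sub_diagram \<Rightarrow> bool" where
  "R_move D D' \<longleftrightarrow>
     (map_sub_diagram fst D, map_sub_diagram fst D')
       \<in> move_I \<union> move_II \<union> move_III \<union> move_IV \<union> move_V \<union> move_VI \<and>
     well_oriented D \<and> well_oriented D' \<and>
     map snd (boundary D) = map snd (boundary D')"


section \<open>Boltzmann weight functions\<close>

definition weight ::
  "(('q \<times> dir) special_point \<Rightarrow> int) \<Rightarrow> (nat \<times> dir) sub_diagram \<Rightarrow> (nat set \<Rightarrow> 'q) \<Rightarrow> int" where
  "weight w D C = (\<Sum>p \<leftarrow> points (colored D C). w p)"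

text \<open>Corresponding colorings of the two sides are those which agree on the boundary of the disc.\<close>

definition boltzmann ::
  "('q \<Rightarrow> 'q \<Rightarrow> 'q) \<Rightarrow> ('q \<Rightarrow> 'q) \<Rightarrow> (('q \<times> dir) special_point \<Rightarrow> int) \<Rightarrow> bool" where
  "boltzmann tri sq w \<longleftrightarrow>
     (\<forall>D D' C C'. R_move D D' \<longrightarrow> coloring tri sq D C \<longrightarrow> coloring tri sq D' C' \<longrightarrow>
        boundary (colored D C) = boundary (colored D' C') \<longrightarrow>
        weight w D C = weight w D' C')"

text \<open>The two incoming ends of a zip vertex, and the two outgoing ones of an unzip vertex, carry the
  same color, so it does not matter that the first of them is picked.\<close>

fun squandle_weight ::
  "('q \<Rightarrow> 'q \<Rightarrow> int) \<Rightarrow> ('q \<Rightarrow> int) \<Rightarrow> ('q \<times> dir) special_point \<Rightarrow> int" where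
  "squandle_weight \<chi> lam (Crossing u x v y) =
     (let r = right_under (Crossing u x v y)
      in if snd r = Head then \<chi> (fst r) (fst x) else - \<chi> (fst r) (fst x))"
| "squandle_weight \<chi> lam (Vertex x y z) =
     (if unzip_vertex (Vertex x y z) then lam (fst (hd (outgoing (Vertex x y z))))
      else - lam (fst (hd (incoming (Vertex x y z)))))"

end

theory Submission
  imports Defs
begin

text \<open>
  The four equations of a squandle 2-cocycle express invariance under four of the R-moves:
  move I gives \<open>\<chi> a a = 0\<close>, move III the equation with three elements, move IV the one for
  \<open>\<chi> a (sq b)\<close> and move VI the one for \<open>\<chi> (sq a) b\<close>. Move II gives no condition, since its two
  crossings have the same colors and opposite signs. Move V gives \<open>\<chi> a a = 0\<close>,
  \<open>\<chi> a (sq a) = 0\<close> or \<open>\<chi> (sq a) a = 0\<close>, according to which edges at the vertex cross; the last two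
  follow from the cocycle equations by idempotence.

  That one equation covers all orientations has the following reason. Reversing an under-strand
  changes the sign of all its crossings on both sides of the move. Reversing an over-strand \<open>b\<close>
  exchanges the right and the left of it, but not the rule that the color on the left is obtained
  from the one on the right by \<open>\<lambda>a. tri a b\<close>; so the same relations hold between the colors, except
  that they start at another corner of the picture. For instance, in move III the lowest strand takes
  four colors, two outside and one inside each of the two sub-diagrams, which form a square
  \<open>a, tri a b, tri a c, tri (tri a b) c\<close>. The orientations of the two upper strands only decide which
  of the four places carries the corner \<open>a\<close>, and the difference of the two weights is in any case,
  up to sign, the difference of the two sides of the first cocycle equation.

  The weights can be compared without solving for the colors: all the relations needed are
  coloring rules at crossings and vertices of one of the two sides. Conversely, each equation is read
  off from one orientation; the squandle axiom that corresponds to the move is what makes the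
  evident colorings of the two sides agree on the boundary.
\<close>


section \<open>Colorings of edges\<close>

text \<open>
  A coloring of arcs is the same as a coloring of edges that takes the same value on the two
  over-edges of each crossing. The latter can be handled one special point at a time, whereas
  arcs depend on the whole sub-diagram.
\<close>

definition paint :: "(nat \<Rightarrow> 'q) \<Rightarrow> (nat \<times> dir) sub_diagram \<Rightarrow> ('q \<times> dir) sub_diagram" where
  "paint f D = map_sub_diagram (\<lambda>(e, d). (f e, d)) D"

definition edge_coloring ::
  "('q \<Rightarrow> 'q \<Rightarrow> 'q) \<Rightarrow> ('q \<Rightarrow> 'q) \<Rightarrow> (nat \<times> dir) sub_diagram \<Rightarrow> (nat \<Rightarrow> 'q) \<Rightarrow> bool" where
  "edge_coloring tri sq D f \<longleftrightarrow>
     (\<forall>(e, e') \<in> over_pairs D. f e = f e') \<and>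
     (\<forall>p \<in> set (points (paint f D)). coloring_rule tri sq p)"

definition edge_weight ::
  "(('q \<times> dir) special_point \<Rightarrow> int) \<Rightarrow> (nat \<times> dir) sub_diagram \<Rightarrow> (nat \<Rightarrow> 'q) \<Rightarrow> int" where
  "edge_weight w D f = (\<Sum>p \<leftarrow> points (paint f D). w p)"

lemma colored_eq_paint: "colored D C = paint (\<lambda>e. C (arc_of D e)) D"
  by (simp add: colored_def paint_def)

lemma arc_of_eq:
  assumes "(e, e') \<in> over_pairs D"
  shows "arc_of D e = arc_of D e'"
proof -
  let ?r = "over_pairs D \<union> (over_pairs D)\<inverse>"
  have "(e, e') \<in> ?r\<^sup>*" "(e', e) \<in> ?r\<^sup>*"
    using assms by auto
  then show ?thesis
    unfolding arc_of_def by (auto intro: rtrancl_trans)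
qed

lemma edge_coloring_of_coloring:
  "coloring tri sq D C \<Longrightarrow> edge_coloring tri sq D (\<lambda>e. C (arc_of D e))"
  by (auto simp: coloring_def edge_coloring_def colored_eq_paint dest: arc_of_eq)

lemma coloring_of_edge_coloring:
  assumes "edge_coloring tri sq D f"
  obtains C where "coloring tri sq D C" "\<And>e. C (arc_of D e) = f e"
proof -
  have const: "f e' = f e" if "e' \<in> arc_of D e" for e e'
  proof -
    have "(e, e') \<in> (over_pairs D \<union> (over_pairs D)\<inverse>)\<^sup>*"
      using that by (simp add: arc_of_def)
    then show ?thesis
      by induction (use assms in \<open>auto simp: edge_coloring_def\<close>)
  qed
  define C where "C A = f (SOME e. e \<in> A)" for A
  have C: "C (arc_of D e) = f e" for e
    unfolding C_def by (rule const, rule someI[of _ e]) (simp add: arc_of_def)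
  have "coloring tri sq D C"
    using assms by (simp add: coloring_def edge_coloring_def colored_eq_paint C)
  with C that show thesis by blast
qed

text \<open>
  The Boltzmann property for an arbitrary set of unoriented moves, so that the moves can be treated
  one type at a time. The directions on the boundary need not be compared separately: they are part
  of the painted boundary.
\<close>

definition invariant ::
  "('q \<Rightarrow> 'q \<Rightarrow> 'q) \<Rightarrow> ('q \<Rightarrow> 'q) \<Rightarrow> (('q \<times> dir) special_point \<Rightarrow> int) \<Rightarrow>
   (nat sub_diagram \<times> nat sub_diagram) set \<Rightarrow> bool" where
  "invariant tri sq w M \<longleftrightarrow>
     (\<forall>D D' f g. (map_sub_diagram fst D, map_sub_diagram fst D') \<in> M \<longrightarrow>
        well_oriented D \<longrightarrow> well_oriented D' \<longrightarrow>
        edge_coloring tri sq D f \<longrightarrow> edge_coloring tri sq D' g \<longrightarrow>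
        boundary (paint f D) = boundary (paint g D') \<longrightarrow>
        edge_weight w D f = edge_weight w D' g)"

lemma invariantD:
  assumes "invariant tri sq w M"
    and "(map_sub_diagram fst D, map_sub_diagram fst D') \<in> M"
    and "well_oriented D" "well_oriented D'"
    and "edge_coloring tri sq D f" "edge_coloring tri sq D' g"
    and "boundary (paint f D) = boundary (paint g D')"
  shows "edge_weight w D f = edge_weight w D' g"
  using assms unfolding invariant_def by blast

lemma invariant_Un:
  "invariant tri sq w (M \<union> N) \<longleftrightarrow> invariant tri sq w M \<and> invariant tri sq w N"
  unfolding invariant_def by blast

lemma invariant_insert:
  "invariant tri sq w (insert m M) \<longleftrightarrow> invariant tri sq w {m} \<and> invariant tri sq w M"
  unfolding invariant_def by blast

lemma snd_boundary_paint: "map snd (boundary (paint f D)) = map snd (boundary D)"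
  by (cases D) (auto simp: paint_def)

lemma boltzmann_iff_invariant:
  "boltzmann tri sq w \<longleftrightarrow>
     invariant tri sq w (move_I \<union> move_II \<union> move_III \<union> move_IV \<union> move_V \<union> move_VI)"
    (is "_ \<longleftrightarrow> invariant tri sq w ?M")
proof
  assume inv: "invariant tri sq w ?M"
  show "boltzmann tri sq w"
    unfolding boltzmann_def
  proof (intro allI impI)
    fix D D' C C'
    assume "R_move D D'" "coloring tri sq D C" "coloring tri sq D' C'"
      "boundary (colored D C) = boundary (colored D' C')"
    then show "weight w D C = weight w D' C'"
      using invariantD[OF inv, of D D' "\<lambda>e. C (arc_of D e)" "\<lambda>e. C' (arc_of D' e)"]
      by (simp add: R_move_def edge_coloring_of_coloring colored_eq_paint weight_def edge_weight_def)
  qed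
next
  assume boltz: "boltzmann tri sq w"
  show "invariant tri sq w ?M"
    unfolding invariant_def
  proof (intro allI impI)
    fix D D' f g
    assume M: "(map_sub_diagram fst D, map_sub_diagram fst D') \<in> ?M"
      and wo: "well_oriented D" "well_oriented D'"
      and f: "edge_coloring tri sq D f" and g: "edge_coloring tri sq D' g"
      and bd: "boundary (paint f D) = boundary (paint g D')"
    obtain C where C: "coloring tri sq D C" "\<And>e. C (arc_of D e) = f e"
      using coloring_of_edge_coloring[OF f] by blast
    obtain C' where C': "coloring tri sq D' C'" "\<And>e. C' (arc_of D' e) = g e"
      using coloring_of_edge_coloring[OF g] by blast
    have "R_move D D'"
      using M wo bd snd_boundary_paint[of f D] snd_boundary_paint[of g D']
      by (simp add: R_move_def)
    then have "weight w D C = weight w D' C'"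
      using boltz C C' bd by (simp add: boltzmann_def colored_eq_paint)
    then show "edge_weight w D f = edge_weight w D' g"
      by (simp add: weight_def edge_weight_def colored_eq_paint C C')
  qed
qed


section \<open>Orientations of a given shape\<close>

text \<open>
  The rules of this section turn the orientations of a shape into variables of type \<open>dir\<close>, one for
  each strand: well-orientedness becomes a list of equations between directions, which clarification
  solves by substitution.
\<close>

fun opp :: "dir \<Rightarrow> dir" where
  "opp Head = Tail"
| "opp Tail = Head"

lemma opp_opp [simp]: "opp (opp d) = d"
  by (cases d) auto

lemma opp_eq_iff [simp]: "opp c = opp d \<longleftrightarrow> c = d"
  by (cases c; cases d) auto

lemma not_eq_iff_opp: "c \<noteq> d \<longleftrightarrow> d = opp c"
  by (cases c; cases d) auto

definition both_directions :: "dir list \<Rightarrow> bool" where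
  "both_directions ds \<longleftrightarrow> (\<forall>d. count_list ds d = 1)"

lemma both_directions_iff: "both_directions [c, d] \<longleftrightarrow> d = opp c"
proof -
  have "(\<forall>e. P e) \<longleftrightarrow> P Head \<and> P Tail" for P
    using dir.exhaust by metis
  then show ?thesis
    by (cases c; cases d) (simp_all add: both_directions_def)
qed

lemma count_list_edge:
  "count_list xs (e, d) = count_list (map snd (filter (\<lambda>x. fst x = e) xs)) d"
  by (induction xs) auto

lemma well_oriented_iff:
  "well_oriented D \<longleftrightarrow>
     (\<forall>e \<in> fst ` set (all_ends D).
        both_directions (map snd (filter (\<lambda>x. fst x = e) (all_ends D)))) \<and>
     (\<forall>p \<in> set (points D). well_oriented_point p)"
  unfolding well_oriented_def both_directions_def count_list_edge by simp

lemma well_oriented_vertex: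
  "well_oriented_point (Vertex (x, a) (y, b) (z, c)) \<longleftrightarrow> \<not> (a = b \<and> b = c)"
  by (cases a; cases b; cases c) (simp_all add: incoming_def outgoing_def)

declare well_oriented_point.simps(2) [simp del]

text \<open>
  The cases say which of the three edges carries the square: it is the one whose direction differs
  from that of the other two. The assumption is the normal form of \<open>well_oriented_vertex\<close> with
  respect to \<open>not_eq_iff_opp\<close>.
\<close>

lemma square_edge_cases:
  assumes "b = opp a \<or> c = opp b"
  obtains "b = opp a" "c = opp a" | "b = opp a" "c = a" | "b = a" "c = opp a"
  using assms by (cases a; cases b; cases c) auto

lemma map_point_eq:
  "map_special_point fst p = Crossing u x v y \<longleftrightarrow>
     (\<exists>a b c d. p = Crossing (u, a) (x, b) (v, c) (y, d))"
  "map_special_point fst p = Vertex x y z \<longleftrightarrow>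
     (\<exists>a b c. p = Vertex (x, a) (y, b) (z, c))"
  by (cases p; fastforce)+

lemma map_diagram_eq:
  "map_sub_diagram fst D = Sub_Diagram ps bs \<longleftrightarrow>
     (\<exists>ps' bs'. D = Sub_Diagram ps' bs' \<and> map (map_special_point fst) ps' = ps \<and> map fst bs' = bs)"
  by (cases D) auto

lemma boundary_paint:
  "boundary (paint f (Sub_Diagram ps bs)) = map (\<lambda>(e, d). (f e, d)) bs"
  by (simp add: paint_def)

lemmas shape_simps = invariant_def map_diagram_eq map_eq_Cons_conv map_point_eq

lemmas orientation_simps =
  well_oriented_iff all_ends_def both_directions_iff well_oriented_vertex boundary_paint
  not_eq_iff_opp


section \<open>Colorings and weights, point by point\<close>

lemma over_pairs_crossing:
  "over_pairs (Sub_Diagram (Crossing u x v y # ps) bs) =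
     insert (fst x, fst y) (over_pairs (Sub_Diagram ps bs))"
  unfolding over_pairs_def by (auto simp del: split_paired_Ex)

lemma over_pairs_vertex:
  "over_pairs (Sub_Diagram (Vertex x y z # ps) bs) = over_pairs (Sub_Diagram ps bs)"
  by (simp add: over_pairs_def)

lemma edge_coloring_Nil: "edge_coloring tri sq (Sub_Diagram [] bs) f"
  by (simp add: edge_coloring_def over_pairs_def paint_def)

lemma edge_coloring_crossing:
  "edge_coloring tri sq (Sub_Diagram (Crossing (u, a) (x, b) (v, c) (y, d) # ps) bs) f \<longleftrightarrow>
     f x = f y \<and> (if b = Head then f u = tri (f v) (f x) else f v = tri (f u) (f x)) \<and>
     edge_coloring tri sq (Sub_Diagram ps bs) f"
  by (auto simp: edge_coloring_def paint_def over_pairs_crossing)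

text \<open>
  In moves I and V the two under-edges turn out to have the same color for other reasons; their own
  rule would then be circular.
\<close>

lemma edge_coloring_crossingD:
  "edge_coloring tri sq (Sub_Diagram (Crossing (u, a) (x, b) (v, c) (y, d) # ps) bs) f \<Longrightarrow>
     f x = f y \<and> edge_coloring tri sq (Sub_Diagram ps bs) f"
  by (simp add: edge_coloring_crossing)

lemma edge_coloring_vertex:
  "edge_coloring tri sq (Sub_Diagram (Vertex (x, d) (y, opp d) (z, opp d) # ps) bs) f \<longleftrightarrow>
     f z = f y \<and> f x = sq (f y) \<and> edge_coloring tri sq (Sub_Diagram ps bs) f"
  "edge_coloring tri sq (Sub_Diagram (Vertex (x, d) (y, opp d) (z, d) # ps) bs) f \<longleftrightarrow>
     f x = f z \<and> f y = sq (f z) \<and> edge_coloring tri sq (Sub_Diagram ps bs) f"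
  "edge_coloring tri sq (Sub_Diagram (Vertex (x, d) (y, d) (z, opp d) # ps) bs) f \<longleftrightarrow>
     f x = f y \<and> f z = sq (f y) \<and> edge_coloring tri sq (Sub_Diagram ps bs) f"
  by (cases d; force simp: edge_coloring_def paint_def over_pairs_vertex incoming_def outgoing_def)+

lemma edge_weight_Nil: "edge_weight w (Sub_Diagram [] bs) f = 0"
  by (simp add: edge_weight_def paint_def)

lemma edge_weight_crossing:
  "edge_weight (squandle_weight \<chi> lam)
      (Sub_Diagram (Crossing (u, a) (x, b) (v, c) (y, d) # ps) bs) f =
    (if b = Head then (if c = Head then \<chi> (f v) (f x) else - \<chi> (f v) (f x))
     else (if a = Head then \<chi> (f u) (f x) else - \<chi> (f u) (f x))) +
    edge_weight (squandle_weight \<chi> lam) (Sub_Diagram ps bs) f"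
  by (simp add: edge_weight_def paint_def)

lemma edge_weight_vertex:
  "edge_weight (squandle_weight \<chi> lam) (Sub_Diagram (Vertex (x, d) (y, opp d) (z, opp d) # ps) bs) f =
    (if d = Head then lam (f y) else - lam (f y)) +
    edge_weight (squandle_weight \<chi> lam) (Sub_Diagram ps bs) f"
  "edge_weight (squandle_weight \<chi> lam) (Sub_Diagram (Vertex (x, d) (y, opp d) (z, d) # ps) bs) f =
    (if d = Tail then lam (f x) else - lam (f x)) +
    edge_weight (squandle_weight \<chi> lam) (Sub_Diagram ps bs) f"
  "edge_weight (squandle_weight \<chi> lam) (Sub_Diagram (Vertex (x, d) (y, d) (z, opp d) # ps) bs) f =
    (if d = Tail then lam (f x) else - lam (f x)) +
    edge_weight (squandle_weight \<chi> lam) (Sub_Diagram ps bs) f"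
  by (cases d; simp add: edge_weight_def paint_def incoming_def outgoing_def)+

lemmas coloring_simps =
  edge_coloring_Nil edge_coloring_crossing
  edge_coloring_vertex[where d = Head, unfolded opp.simps]
  edge_coloring_vertex[where d = Tail, unfolded opp.simps]
  edge_weight_Nil edge_weight_crossing
  edge_weight_vertex[where d = Head, unfolded opp.simps]
  edge_weight_vertex[where d = Tail, unfolded opp.simps]


section \<open>The cocycle equations imply invariance\<close>

text \<open>
  The proofs have a common pattern. The first two clarifications write both sides of the move with
  one direction for each strand (and with the normal form of well-orientedness at the vertex, if there
  is one); then the directions are split. In each case, the coloring rules are the relations
  between the colors that occur in an instance of the assumed equation. Where the
  relations may be cyclic as rewrite rules, such as \<open>g 1 = tri (g 2) (g 3)\<close> with \<open>g 1\<close>, \<open>g 2\<close> and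
  \<open>g 3\<close> equal, the simplifier is kept from using them on each other.
\<close>

text \<open>
  The over-edge next to the curl is also an under-edge of the same crossing, and the boundary
  condition makes the other under-edge have that color, too.
\<close>

lemma invariant_move_I:
  assumes "\<And>a. \<chi> a a = 0"
  shows "invariant tri sq (squandle_weight \<chi> lam) move_I"
  unfolding move_I_def
  apply (rule invariant_insert[THEN iffD2], intro conjI)
   apply (clarsimp simp: shape_simps, clarsimp simp: orientation_simps)
   apply (drule edge_coloring_crossingD, simp add: edge_weight_Nil edge_weight_crossing assms)
  apply (clarsimp simp: shape_simps, clarsimp simp: orientation_simps)
  apply (drule edge_coloring_crossingD, simp add: edge_weight_Nil edge_weight_crossing assms)
  done

lemma invariant_move_II: "invariant tri sq (squandle_weight \<chi> lam) move_II"
  unfolding move_II_def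
  apply (clarsimp simp: shape_simps, clarsimp simp: orientation_simps)
  subgoal for over under
    by (cases over; cases under; simp add: coloring_simps)
  done

text \<open>
  Two shapes, each with eight orientations; the color of the middle strand is that of its part to
  the right of the top strand on one side of the move, and of its part to the left on the other.
\<close>

lemma invariant_move_III:
  assumes "\<And>a b c. \<chi> a b + \<chi> (tri a b) c = \<chi> (tri a c) (tri b c) + \<chi> a c"
  shows "invariant tri sq (squandle_weight \<chi> lam) move_III"
  unfolding move_III_def
  apply (rule invariant_insert[THEN iffD2], intro conjI)
   apply (clarsimp simp: shape_simps, clarsimp simp: orientation_simps)
  subgoal for a b c
    by (cases a; cases b; cases c; hypsubst; simp (no_asm_use) add: coloring_simps;
        smt (verit) assms)
  apply (clarsimp simp: shape_simps, clarsimp simp: orientation_simps)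
  subgoal for a b c
    by (cases a; cases b; cases c; hypsubst; simp (no_asm_use) add: coloring_simps;
        smt (verit) assms)
  done

text \<open>
  If the square lies on one of the two southern edges, then the other two edges of the vertex
  cross the moving strand in opposite senses with respect to it, and the equation appears with
  \<open>\<chi> (tri a b) b\<close> moved to the other side.
\<close>

lemma invariant_move_IV:
  assumes "\<And>a b. \<chi> a (sq b) = \<chi> a b + \<chi> (tri a b) b"
  shows "invariant tri sq (squandle_weight \<chi> lam) move_IV"
  unfolding move_IV_def
  apply (clarsimp simp: shape_simps, clarsimp simp: orientation_simps)
  subgoal for under north southwest southeast
    by (erule square_edge_cases; cases under; cases north; simp add: coloring_simps assms)
  done

text \<open>
  The rules at the two vertices alone force the two under-edges at the crossing to have the same
  color, so the crossing has weight zero whichever of the edges carries the square.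
\<close>

lemma invariant_move_V:
  assumes "\<And>a. \<chi> a a = 0" "\<And>a. \<chi> a (sq a) = 0" "\<And>a. \<chi> (sq a) a = 0"
  shows "invariant tri sq (squandle_weight \<chi> lam) move_V"
  unfolding move_V_def
  apply (rule invariant_insert[THEN iffD2], intro conjI)
   apply (clarsimp simp: shape_simps, clarsimp simp: orientation_simps)
  subgoal for southwest southeast north
    apply (drule edge_coloring_crossingD)
    by (erule square_edge_cases[of southeast]; cases southwest; hypsubst;
        simp (no_asm_use) add: coloring_simps; smt (verit) assms)
  apply (clarsimp simp: shape_simps, clarsimp simp: orientation_simps)
  subgoal for southwest southeast north
    apply (drule edge_coloring_crossingD)
    by (erule square_edge_cases[of southeast]; cases southwest; hypsubst;
        simp (no_asm_use) add: coloring_simps; smt (verit) assms)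
  done

text \<open>
  On one side of the move the vertex lies to the right of the moving strand \<open>b\<close> and has weight
  \<open>lam a\<close> up to sign, on the other side it lies to the left and has weight \<open>lam (tri a b)\<close>.
\<close>

lemma invariant_move_VI:
  assumes "\<And>a b. \<chi> (sq a) b + lam (tri a b) = 2 * \<chi> a b + lam a"
  shows "invariant tri sq (squandle_weight \<chi> lam) move_VI"
  unfolding move_VI_def
  apply (clarsimp simp: shape_simps, clarsimp simp: orientation_simps)
  subgoal for over north southwest southeast
    by (erule square_edge_cases; cases over; cases north; hypsubst;
        simp (no_asm_use) add: coloring_simps; smt (verit) assms)
  done


section \<open>Invariance implies the cocycle equations\<close>

text \<open>
  Orientations are chosen so that the element \<open>a\<close> of the equation is the color of an edge of the
  sub-diagram to the right of all over-strands that it meets.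
\<close>

lemma cocycle_of_move_I:
  assumes "invariant tri sq (squandle_weight \<chi> lam) move_I"
    and "tri a a = a"
  shows "\<chi> a a = 0"
proof -
  let ?D = "Sub_Diagram [] [(1, Tail), (1, Head)]"
  let ?D' = "Sub_Diagram [Crossing (1, Head) (3, Tail) (2, Tail) (2, Head)] [(1, Tail), (3, Head)]"
  have "edge_weight (squandle_weight \<chi> lam) ?D (\<lambda>_. a) =
      edge_weight (squandle_weight \<chi> lam) ?D' (\<lambda>_. a)"
    by (rule invariantD[OF assms(1)])
      (simp_all add: move_I_def orientation_simps coloring_simps assms(2))
  then show ?thesis
    by (simp add: coloring_simps)
qed

text \<open>
  The lowest strand enters with color \<open>a\<close>. It passes under \<open>b\<close> and then under \<open>c\<close> on one side of
  the move, under \<open>c\<close> and then under \<open>tri b c\<close> on the other; distributivity is the condition that it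
  leaves with the same color. The weights \<open>\<chi> b c\<close> of the remaining crossing cancel.
\<close>

lemma cocycle_of_move_III:
  assumes "invariant tri sq (squandle_weight \<chi> lam) move_III"
    and "tri (tri a b) c = tri (tri a c) (tri b c)"
  shows "\<chi> a b + \<chi> (tri a b) c = \<chi> (tri a c) (tri b c) + \<chi> a c"
proof -
  let ?bd = "[(1, Tail), (4, Head), (9, Head), (3, Head), (6, Tail), (7, Tail)]"
  let ?D = "Sub_Diagram [Crossing (1, Head) (4, Tail) (2, Tail) (5, Head),
    Crossing (2, Head) (9, Tail) (3, Tail) (8, Head),
    Crossing (5, Tail) (8, Tail) (6, Head) (7, Head)] ?bd"
  let ?D' = "Sub_Diagram [Crossing (1, Head) (8, Tail) (2, Tail) (7, Head),
    Crossing (2, Head) (5, Tail) (3, Tail) (6, Head),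
    Crossing (4, Tail) (9, Tail) (5, Head) (8, Head)] ?bd"
  let ?f = "(\<lambda>_. c)
    (1 := a, 2 := tri a b, 3 := tri (tri a b) c, 4 := b, 5 := b, 6 := tri b c)"
  let ?g = "(\<lambda>_. c)
    (1 := a, 2 := tri a c, 3 := tri (tri a b) c, 4 := b, 5 := tri b c, 6 := tri b c)"
  have "edge_weight (squandle_weight \<chi> lam) ?D ?f = edge_weight (squandle_weight \<chi> lam) ?D' ?g"
    by (rule invariantD[OF assms(1)])
      (simp_all add: move_III_def orientation_simps coloring_simps assms(2))
  then show ?thesis
    by (simp add: coloring_simps)
qed

text \<open>
  At an unzip vertex whose square edge points to it from the north, the strand \<open>a\<close> passes under
  \<open>sq b\<close> on one side of the move and twice under \<open>b\<close> on the other. The two vertices cancel.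
\<close>

lemma cocycle_of_move_IV:
  assumes "invariant tri sq (squandle_weight \<chi> lam) move_IV"
    and "tri a (sq b) = tri (tri a b) b"
  shows "\<chi> a (sq b) = \<chi> a b + \<chi> (tri a b) b"
proof -
  let ?D = "Sub_Diagram [Crossing (1, Head) (5, Tail) (2, Tail) (4, Head),
    Vertex (5, Head) (6, Tail) (7, Tail)]
    [(1, Tail), (6, Head), (7, Head), (2, Head), (4, Tail)]"
  let ?D' = "Sub_Diagram [Crossing (1, Head) (6, Tail) (2, Tail) (8, Head),
    Crossing (2, Head) (7, Tail) (3, Tail) (9, Head), Vertex (4, Head) (8, Tail) (9, Tail)]
    [(1, Tail), (6, Head), (7, Head), (3, Head), (4, Tail)]"
  let ?f = "(\<lambda>_. b)(1 := a, 2 := tri a (sq b), 4 := sq b, 5 := sq b)"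
  let ?g = "(\<lambda>_. b)(1 := a, 2 := tri a b, 3 := tri a (sq b), 4 := sq b)"
  have "edge_weight (squandle_weight \<chi> lam) ?D ?f = edge_weight (squandle_weight \<chi> lam) ?D' ?g"
    by (rule invariantD[OF assms(1)])
      (simp_all add: move_IV_def orientation_simps coloring_simps assms(2))
  then show ?thesis
    by (simp add: coloring_simps)
qed

text \<open>
  The strand \<open>b\<close> runs from W to E, so its right is the south, where the edges have the colors \<open>a\<close>,
  \<open>a\<close> and \<open>sq a\<close>. They run southwards and thus from left to right of \<open>b\<close>, so that all crossings
  count negatively.
\<close>

lemma cocycle_of_move_VI:
  assumes "invariant tri sq (squandle_weight \<chi> lam) move_VI"
    and "tri (sq a) b = sq (tri a b)"
  shows "\<chi> (sq a) b + lam (tri a b) = 2 * \<chi> a b + lam a"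
proof -
  let ?D = "Sub_Diagram [Crossing (5, Tail) (2, Tail) (4, Head) (1, Head),
    Vertex (5, Head) (6, Tail) (7, Tail)]
    [(1, Tail), (6, Head), (7, Head), (2, Head), (4, Tail)]"
  let ?D' = "Sub_Diagram [Crossing (6, Tail) (2, Tail) (8, Head) (1, Head),
    Crossing (7, Tail) (3, Tail) (9, Head) (2, Head), Vertex (4, Head) (8, Tail) (9, Tail)]
    [(1, Tail), (6, Head), (7, Head), (3, Head), (4, Tail)]"
  let ?f = "(\<lambda>_. b)(4 := sq (tri a b), 5 := sq a, 6 := a, 7 := a)"
  let ?g = "(\<lambda>_. b)(4 := sq (tri a b), 6 := a, 7 := a, 8 := tri a b, 9 := tri a b)"
  have "edge_weight (squandle_weight \<chi> lam) ?D ?f = edge_weight (squandle_weight \<chi> lam) ?D' ?g"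
    by (rule invariantD[OF assms(1)])
      (simp_all add: move_VI_def orientation_simps coloring_simps assms(2))
  then show ?thesis
    by (simp add: coloring_simps)
qed


section \<open>The characterization of Boltzmann weights\<close>

theorem proposition6p18:
  fixes tri :: "'q \<Rightarrow> 'q \<Rightarrow> 'q" and sq :: "'q \<Rightarrow> 'q"
    and \<chi> :: "'q \<Rightarrow> 'q \<Rightarrow> int" and lam :: "'q \<Rightarrow> int"
  assumes "squandle tri sq"
  shows "boltzmann tri sq (squandle_weight \<chi> lam) \<longleftrightarrow> squandle_2_cocycle tri sq \<chi> lam"
proof -
  have self_distrib: "tri (tri a b) c = tri (tri a c) (tri b c)"
    and idem: "tri a a = a"
    and act_sq: "tri a (sq b) = tri (tri a b) b"
    and sq_act: "tri (sq a) b = sq (tri a b)" for a b c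
    using assms unfolding squandle_def by metis+
  show ?thesis
    unfolding boltzmann_iff_invariant invariant_Un
  proof (intro iffI)
    assume "squandle_2_cocycle tri sq \<chi> lam"
    then have III: "\<chi> a b + \<chi> (tri a b) c = \<chi> (tri a c) (tri b c) + \<chi> a c"
      and I: "\<chi> a a = 0"
      and IV: "\<chi> a (sq b) = \<chi> a b + \<chi> (tri a b) b"
      and VI: "\<chi> (sq a) b + lam (tri a b) = 2 * \<chi> a b + lam a" for a b c
      unfolding squandle_2_cocycle_def by blast+
    have V: "\<chi> a (sq a) = 0" "\<chi> (sq a) a = 0" for a
      using IV[of a a] VI[of a a] by (simp_all add: I idem)
    show "((((invariant tri sq (squandle_weight \<chi> lam) move_I \<and>
      invariant tri sq (squandle_weight \<chi> lam) move_II) \<and>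
      invariant tri sq (squandle_weight \<chi> lam) move_III) \<and>
      invariant tri sq (squandle_weight \<chi> lam) move_IV) \<and>
      invariant tri sq (squandle_weight \<chi> lam) move_V) \<and>
      invariant tri sq (squandle_weight \<chi> lam) move_VI"
      by (intro conjI invariant_move_I invariant_move_II invariant_move_III invariant_move_IV
          invariant_move_V invariant_move_VI I III IV V VI)
  next
    assume inv: "((((invariant tri sq (squandle_weight \<chi> lam) move_I \<and>
      invariant tri sq (squandle_weight \<chi> lam) move_II) \<and>
      invariant tri sq (squandle_weight \<chi> lam) move_III) \<and>
      invariant tri sq (squandle_weight \<chi> lam) move_IV) \<and>
      invariant tri sq (squandle_weight \<chi> lam) move_V) \<and>
      invariant tri sq (squandle_weight \<chi> lam) move_VI"
    show "squandle_2_cocycle tri sq \<chi> lam"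
      unfolding squandle_2_cocycle_def
    proof (intro allI)
      fix a b c
      have "\<chi> a b + \<chi> (tri a b) c = \<chi> (tri a c) (tri b c) + \<chi> a c"
        using inv cocycle_of_move_III[of tri sq \<chi> lam a b c, OF _ self_distrib] by blast
      moreover have "\<chi> a a = 0"
        using inv cocycle_of_move_I[of tri sq \<chi> lam a, OF _ idem] by blast
      moreover have "\<chi> a (sq b) = \<chi> a b + \<chi> (tri a b) b"
        using inv cocycle_of_move_IV[of tri sq \<chi> lam a b, OF _ act_sq] by blast
      moreover have "\<chi> (sq a) b + lam (tri a b) = 2 * \<chi> a b + lam a"
        using inv cocycle_of_move_VI[of tri sq \<chi> lam a b, OF _ sq_act] by blast
      ultimately show "\<chi> a b + \<chi> (tri a b) c = \<chi> (tri a c) (tri b c) + \<chi> a c \<and>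
          \<chi> a a = 0 \<and> \<chi> a (sq b) = \<chi> a b + \<chi> (tri a b) b \<and>
          \<chi> (sq a) b + lam (tri a b) = 2 * \<chi> a b + lam a"
        by blast
    qed
  qed
qed

end
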